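(* Let $n\in\mathbb{N}$. Every $n$-Legendrian predicate rack is an $n$-Legendrian rack; that is, its underlying rack satisfies $x^{2n+2}=x$ for all $x$.
   Context: $\mathbb{N}=\{0,1,2,\dots\}$. A rack is a set $R$ with two binary operations $*$ and $/$ such that for all $x,y,z\in R$: $(x*y)*z=(x*z)*(y*z)$, $(x/y)/z=(x/z)/(y/z)$, $(x*y)/y=x$, $(x/y)*y=x$. Powers $x^m$ are defined for $m\in\mathbb{Z}\setminus\{0,-1\}$ by $x^1=x$, $x^m=x^{m-1}*x$ for $m>1$, $x^{-2}=x/x$, $x^m=x^{m+1}/x$ for $m<-2$. An $n$-Legendrian rack is a rack with $x^{2n+2}=x$ for all $x$. An $n$-Legendrian predicate rack is a rack together with two binary predicates $U$ and $D$ on it such that for all $x,y,z$: (1a) $(U(x*z,y)\wedge D(y,z))\leftrightarrow (x=z\wedge y=x^{n+2})$; (1b) $(D(y,z/x)\wedge U(x,y))\leftrightarrow (x=z\wedge y=x^{-(n+2)})$; (1c) $(D(x,y)\wedge U(y,z/x))\leftrightarrow (x=z\wedge y=x^{-(n+2)})$; (1d) $(D(x*z,y)\wedge U(y,z))\leftrightarrow (x=z\wedge y=x^{n+2})$; (2a) $U(x,y)\leftrightarrow U(x*z,y*z)$; (2b) $D(x,y)\leftrightarrow D(x*z,y*z)$; (2c) $U(x,y)\rightarrow (z/x)*y=z$; (2d) $D(x,y)\rightarrow (z*y)/x=z$. *)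

theory Defs
  imports Main
begin

(* Clause-by-clause recursion on the integer exponent. The powers with exponents 0 and -1
   do not exist and are left undefined. *)
function rack_pow :: "('a \<Rightarrow> 'a \<Rightarrow> 'a) \<Rightarrow> ('a \<Rightarrow> 'a \<Rightarrow> 'a) \<Rightarrow> 'a \<Rightarrow> int \<Rightarrow> 'a" where
  "rack_pow mul dv x m =
    (if m = 1 then x
     else if m > 1 then mul (rack_pow mul dv x (m - 1)) x
     else if m = - 2 then dv x x
     else if m < - 2 then dv (rack_pow mul dv x (m + 1)) x
     else undefined)"
  by pat_completeness auto
termination
  by (relation "measure (\<lambda>(mul, dv, x, m). nat \<bar>m\<bar>)") auto

(* The defining equation loops as an unconditional rewrite rule. *)
declare rack_pow.simps [simp del]

locale rack =
  fixes R :: "'a set"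
    and mul :: "'a \<Rightarrow> 'a \<Rightarrow> 'a"  (infixl "\<star>" 70)
    and dv :: "'a \<Rightarrow> 'a \<Rightarrow> 'a"  (infixl "\<oslash>" 70)
  assumes mul_closed: "\<lbrakk>x \<in> R; y \<in> R\<rbrakk> \<Longrightarrow> x \<star> y \<in> R"
    and dv_closed: "\<lbrakk>x \<in> R; y \<in> R\<rbrakk> \<Longrightarrow> x \<oslash> y \<in> R"
    and mul_distrib: "\<lbrakk>x \<in> R; y \<in> R; z \<in> R\<rbrakk> \<Longrightarrow> (x \<star> y) \<star> z = (x \<star> z) \<star> (y \<star> z)"
    and dv_distrib: "\<lbrakk>x \<in> R; y \<in> R; z \<in> R\<rbrakk> \<Longrightarrow> (x \<oslash> y) \<oslash> z = (x \<oslash> z) \<oslash> (y \<oslash> z)"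
    and mul_dv: "\<lbrakk>x \<in> R; y \<in> R\<rbrakk> \<Longrightarrow> (x \<star> y) \<oslash> y = x"
    and dv_mul: "\<lbrakk>x \<in> R; y \<in> R\<rbrakk> \<Longrightarrow> (x \<oslash> y) \<star> y = x"
begin

abbreviation pow :: "'a \<Rightarrow> int \<Rightarrow> 'a"  (infixr "\<up>" 80)
  where "x \<up> m \<equiv> rack_pow (\<star>) (\<oslash>) x m"

end

locale legendrian_rack = rack R mul dv
  for n :: nat
    and R :: "'a set"
    and mul :: "'a \<Rightarrow> 'a \<Rightarrow> 'a"  (infixl "\<star>" 70)
    and dv :: "'a \<Rightarrow> 'a \<Rightarrow> 'a"  (infixl "\<oslash>" 70) +
  assumes legendrian: "x \<in> R \<Longrightarrow> x \<up> (2 * int n + 2) = x"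

locale legendrian_predicate_rack = rack R mul dv
  for n :: nat
    and R :: "'a set"
    and mul :: "'a \<Rightarrow> 'a \<Rightarrow> 'a"  (infixl "\<star>" 70)
    and dv :: "'a \<Rightarrow> 'a \<Rightarrow> 'a"  (infixl "\<oslash>" 70) +
  fixes U :: "'a \<Rightarrow> 'a \<Rightarrow> bool"
    and D :: "'a \<Rightarrow> 'a \<Rightarrow> bool"
  assumes ax_1a: "\<lbrakk>x \<in> R; y \<in> R; z \<in> R\<rbrakk> \<Longrightarrow>
      (U (x \<star> z) y \<and> D y z) \<longleftrightarrow> (x = z \<and> y = x \<up> (int n + 2))"
    and ax_1b: "\<lbrakk>x \<in> R; y \<in> R; z \<in> R\<rbrakk> \<Longrightarrow>
      (D y (z \<oslash> x) \<and> U x y) \<longleftrightarrow> (x = z \<and> y = x \<up> (- (int n + 2)))"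
    and ax_1c: "\<lbrakk>x \<in> R; y \<in> R; z \<in> R\<rbrakk> \<Longrightarrow>
      (D x y \<and> U y (z \<oslash> x)) \<longleftrightarrow> (x = z \<and> y = x \<up> (- (int n + 2)))"
    and ax_1d: "\<lbrakk>x \<in> R; y \<in> R; z \<in> R\<rbrakk> \<Longrightarrow>
      (D (x \<star> z) y \<and> U y z) \<longleftrightarrow> (x = z \<and> y = x \<up> (int n + 2))"
    and ax_2a: "\<lbrakk>x \<in> R; y \<in> R; z \<in> R\<rbrakk> \<Longrightarrow> U x y \<longleftrightarrow> U (x \<star> z) (y \<star> z)"
    and ax_2b: "\<lbrakk>x \<in> R; y \<in> R; z \<in> R\<rbrakk> \<Longrightarrow> D x y \<longleftrightarrow> D (x \<star> z) (y \<star> z)"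
    and ax_2c: "\<lbrakk>x \<in> R; y \<in> R; z \<in> R\<rbrakk> \<Longrightarrow> U x y \<longrightarrow> (z \<oslash> x) \<star> y = z"
    and ax_2d: "\<lbrakk>x \<in> R; y \<in> R; z \<in> R\<rbrakk> \<Longrightarrow> D x y \<longrightarrow> (z \<star> y) \<oslash> x = z"

end

theory Submission
  imports Defs
begin

text \<open>
  Write \<open>s x = x \<star> x\<close>, a bijection whose inverse is \<open>t x = x \<oslash> x\<close>; then \<open>x \<up> (k + 1) = s\<^sup>k x\<close> and
  \<open>x \<up> -(k + 1) = t\<^sup>k x\<close>, and \<open>x\<close>, \<open>s x\<close>, \<open>t x\<close> all act in the same way from the right. Let
  \<open>p = x \<up> -(n + 2)\<close>, so that \<open>p \<up> (n + 2) = x\<close>. Axiom (1b) gives \<open>U x p\<close>, which (2a) shifts to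
  \<open>U (s x) (s p)\<close>, and axiom (1d) at \<open>p\<close> gives \<open>D (s p) x\<close>. Axiom (1a) now forces
  \<open>s p = x \<up> (n + 2)\<close>, and applying \<open>s\<^sup>n\<close> yields \<open>x = x \<up> (2n + 2)\<close>.
\<close>

context rack
begin

definition sq :: "'a \<Rightarrow> 'a"
  where "sq x = x \<star> x"

definition sqrt :: "'a \<Rightarrow> 'a"
  where "sqrt x = x \<oslash> x"

lemma sq_closed: "x \<in> R \<Longrightarrow> sq x \<in> R"
  by (simp add: sq_def mul_closed)

lemma sqrt_closed: "x \<in> R \<Longrightarrow> sqrt x \<in> R"
  by (simp add: sqrt_def dv_closed)

lemma funpow_sq_closed: "x \<in> R \<Longrightarrow> (sq ^^ k) x \<in> R"
  by (induction k) (auto intro: sq_closed)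

lemma funpow_sqrt_closed: "x \<in> R \<Longrightarrow> (sqrt ^^ k) x \<in> R"
  by (induction k) (auto intro: sqrt_closed)

text \<open>Self-distributivity makes right translation by \<open>sq x\<close> the conjugate of
  right translation by \<open>x\<close> by itself, hence the same map.\<close>

lemma mul_sq:
  assumes "x \<in> R" "y \<in> R"
  shows "y \<star> sq x = y \<star> x"
  using mul_distrib[of "y \<oslash> x" x x] assms by (simp add: sq_def dv_closed dv_mul)

lemma mul_sqrt:
  assumes "x \<in> R" "y \<in> R"
  shows "y \<star> sqrt x = y \<star> x"
proof -
  have "(y \<star> sqrt x) \<star> x = (y \<star> x) \<star> x"
    using mul_distrib[of y "sqrt x" x] assms by (simp add: sqrt_def dv_closed dv_mul)
  then show ?thesis
    by (metis assms mul_closed mul_dv sqrt_closed)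
qed

lemma dv_sqrt:
  assumes "x \<in> R" "y \<in> R"
  shows "y \<oslash> sqrt x = y \<oslash> x"
  by (metis assms dv_closed dv_mul mul_dv mul_sqrt sqrt_closed)

lemma sq_sqrt: "x \<in> R \<Longrightarrow> sq (sqrt x) = x"
  using mul_sqrt[of x "sqrt x"] sqrt_closed[of x] by (simp add: sq_def sqrt_def dv_mul)

lemma mul_funpow_sq: "\<lbrakk>x \<in> R; y \<in> R\<rbrakk> \<Longrightarrow> y \<star> (sq ^^ k) x = y \<star> x"
  by (induction k) (simp_all add: mul_sq funpow_sq_closed)

lemma dv_funpow_sqrt: "\<lbrakk>x \<in> R; y \<in> R\<rbrakk> \<Longrightarrow> y \<oslash> (sqrt ^^ k) x = y \<oslash> x"
  by (induction k) (simp_all add: dv_sqrt funpow_sqrt_closed)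

lemma funpow_sq_funpow_sqrt: "x \<in> R \<Longrightarrow> (sq ^^ k) ((sqrt ^^ k) x) = x"
proof (induction k)
  case (Suc k)
  \<comment> \<open>One \<open>sq\<close> is moved innermost to cancel the outermost
    \<open>sqrt\<close>.\<close>
  have "(sq ^^ Suc k) ((sqrt ^^ Suc k) x) = (sq ^^ k) (sq (sqrt ((sqrt ^^ k) x)))"
    by (simp add: funpow_swap1[of sq])
  also have "\<dots> = x"
    using Suc by (simp add: sq_sqrt funpow_sqrt_closed)
  finally show ?case .
qed simp

text \<open>A power multiplies by the fixed \<open>x\<close>, an iterate of \<open>sq\<close> by the
  current element; both act alike from the right.\<close>

lemma pow_eq_funpow_sq:
  assumes "x \<in> R"
  shows "x \<up> (int k + 1) = (sq ^^ k) x"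
proof (induction k)
  case 0
  then show ?case by (simp add: rack_pow.simps)
next
  case (Suc k)
  have "x \<up> (int (Suc k) + 1) = (x \<up> (int k + 1)) \<star> x"
    by (subst rack_pow.simps) (simp add: add.commute)
  also have "\<dots> = (sq ^^ k) x \<star> (sq ^^ k) x"
    using Suc assms by (simp add: mul_funpow_sq funpow_sq_closed)
  finally show ?case by (simp add: sq_def[of "(sq ^^ k) x"])
qed

lemma pow_eq_funpow_sqrt:
  assumes "x \<in> R"
  shows "x \<up> (- (int k + 2)) = (sqrt ^^ Suc k) x"
proof (induction k)
  \<comment> \<open>With exponent -1 undefined, the base case is -2, already one
    \<open>sqrt\<close>.\<close>
  case 0
  then show ?case by (simp add: rack_pow.simps sqrt_def)
next
  case (Suc k)
  have "x \<up> (- (int (Suc k) + 2)) = (x \<up> (- (int k + 2))) \<oslash> x"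
    by (subst rack_pow.simps) (simp add: algebra_simps)
  also have "\<dots> = (sqrt ^^ Suc k) x \<oslash> (sqrt ^^ Suc k) x"
    unfolding Suc using assms by (simp only: dv_funpow_sqrt funpow_sqrt_closed)
  finally show ?case by (simp add: sqrt_def[of "sqrt ((sqrt ^^ k) x)"])
qed

end

theorem theorem4p3:
  fixes n :: nat
    and R :: "'a set"
    and mul dv :: "'a \<Rightarrow> 'a \<Rightarrow> 'a"
    and U D :: "'a \<Rightarrow> 'a \<Rightarrow> bool"
  assumes "legendrian_predicate_rack n R mul dv U D"
  shows "legendrian_rack n R mul dv"
proof -
  interpret legendrian_predicate_rack n R mul dv U D by fact
  show ?thesis
  proof unfold_locales
    fix x assume x: "x \<in> R"
    define p where "p = pow x (- (int n + 2))"
    have p_eq: "p = (sqrt ^^ Suc n) x"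
      unfolding p_def using x by (rule pow_eq_funpow_sqrt)
    then have p: "p \<in> R"
      using x by (simp only: funpow_sqrt_closed)
    have root: "(sq ^^ Suc n) p = x"
      unfolding p_eq using x by (rule funpow_sq_funpow_sqrt)
    have pow_n2: "pow y (int n + 2) = (sq ^^ Suc n) y" if "y \<in> R" for y
      using pow_eq_funpow_sq[OF that, of "Suc n"] by (simp add: add.commute)
    \<comment> \<open>By \<open>root\<close>, \<open>x\<close> is an iterated square of
      \<open>p\<close>, so it acts from the right as \<open>p\<close> does.\<close>
    have px: "mul p x = sq p"
      using mul_funpow_sq[OF p p, of "Suc n"] unfolding root by (simp add: sq_def)
    have "U x p"
      using ax_1b[OF x p x] p_def by simp
    then have "U (mul x x) (sq p)"
      using ax_2a[OF x p x] px by simp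
    moreover have "D (sq p) x"
      using ax_1d[OF p x p] pow_n2[OF p] root by (simp add: sq_def)
    ultimately have "sq p = pow x (int n + 2)"
      using ax_1a[OF x sq_closed[OF p] x] by simp
    then have shift: "(sq ^^ Suc n) x = sq p"
      using pow_n2[OF x] by simp
    \<comment> \<open>Of these 2n+1 squarings, \<open>shift\<close> turns the first n+1 into a
      single squaring of \<open>p\<close>; the other n then lead to \<open>x\<close> by
      \<open>root\<close>.\<close>
    have "pow x (2 * int n + 2) = (sq ^^ (n + Suc n)) x"
      using pow_eq_funpow_sq[OF x, of "n + Suc n"] by (simp add: algebra_simps)
    also have "\<dots> = (sq ^^ n) (sq p)"
      unfolding funpow_add comp_apply shift ..
    also have "\<dots> = x"
      using root by (simp add: funpow_swap1)
    finally show "pow x (2 * int n + 2) = x" .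
  qed
qed

end
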